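(* Let $\alpha\in\mathbb{R}$ and let $\varSigma^2\subset\mathbb{E}^3$ be a surface of revolution parametrized by $\psi(u,v)=(a(u)\cos v,a(u)\sin v,b(u))$, $u\in I$, $v\in\mathbb{R}$, where $0\in I$, $a>0$, and the generating curve $c(u)=(a(u),0,b(u))$ is parametrized by arc length. Let $\gamma(t)=\psi(u(t),v(t))$, with $u(t)>0$, be a (regular) $\alpha$-catenary on $\varSigma^2$ with respect to the parallel $u=0$, and suppose that $\gamma$ is not a meridian. If $\theta$ denotes the angle between $\gamma$ and the parallels of $\varSigma^2$, then there exists a constant $c\in\mathbb{R}$ such that $$a(u)\,u^{\alpha}\cos\theta=c$$ along $\gamma$.
   Context: The induced metric on $\varSigma^2$ is $\mathrm{d}s^2=\mathrm{d}u^2+a(u)^2\mathrm{d}v^2$. Parallels are the coordinate curves $v\mapsto\psi(u_0,v)$ and meridians are the coordinate curves $u\mapsto\psi(u,v_0)$. The reference curve is the parallel $\ell(v)=\psi(0,v)$, which is not required to be a geodesic. A curve $\gamma(t)=\psi(u(t),v(t))$, $t\in[t_0,t_1]$, with $u>0$ is an $\alpha$-catenary with respect to $\ell$ if it is a critical point (for smooth variations with fixed endpoints in the region $u>0$) of $$\mathcal{E}[\gamma]=\int_{t_0}^{t_1}u^\alpha\sqrt{\dot u^2+a(u)^2\dot v^2}\,\mathrm{d}t,$$ i.e. $(u(t),v(t))$ satisfies the corresponding Euler-Lagrange equations. The angle $\theta$ at a point of $\gamma$ is the angle between $\dot\gamma$ and $\psi_v=\partial\psi/\partial v$: $\cos\theta=\langle\psi_v,\dot\gamma\rangle/(\Vert\psi_v\Vert\,\Vert\dot\gamma\Vert)$.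 *)

theory Defs
  imports "HOL-Analysis.Analysis"
begin

text \<open>
  Derivatives are taken within \<open>S\<close>, so that they are one-sided at boundary points. This
  is meaningful when derivatives within \<open>S\<close> are unique, e.g. for convex sets with
  nonempty interior: nondegenerate intervals and products of them.
\<close>

fun Ck_on :: "nat \<Rightarrow> 'a::real_normed_vector set \<Rightarrow> ('a \<Rightarrow> 'b::real_normed_vector) \<Rightarrow> bool" where
  "Ck_on 0 S f \<longleftrightarrow> continuous_on S f"
| "Ck_on (Suc k) S f \<longleftrightarrow>
     (\<forall>x\<in>S. f differentiable (at x within S)) \<and>
     (\<forall>h. Ck_on k S (\<lambda>x. frechet_derivative f (at x within S) h))"

definition smooth_on :: "'a::real_normed_vector set \<Rightarrow> ('a \<Rightarrow> 'b::real_normed_vector) \<Rightarrow> bool" where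
  "smooth_on S f \<longleftrightarrow> (\<forall>k. Ck_on k S f)"

definition profile_curve :: "(real \<Rightarrow> real) \<Rightarrow> (real \<Rightarrow> real) \<Rightarrow> real \<Rightarrow> real ^ 3" where
  "profile_curve a b u = vector [a u, 0, b u]"

definition rev_param :: "(real \<Rightarrow> real) \<Rightarrow> (real \<Rightarrow> real) \<Rightarrow> real \<Rightarrow> real \<Rightarrow> real ^ 3" where
  "rev_param a b u v = vector [a u * cos v, a u * sin v, b u]"

text \<open>
  If \<open>I\<close> contains 0 and some positive number, as it does in the presence of a
  curve with \<open>u > 0\<close>, then \<open>I\<close> is automatically nondegenerate.
\<close>

definition surface_of_revolution :: "real set \<Rightarrow> (real \<Rightarrow> real) \<Rightarrow> (real \<Rightarrow> real) \<Rightarrow> bool" where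
  "surface_of_revolution I a b \<longleftrightarrow>
     is_interval I \<and> 0 \<in> I \<and> smooth_on I a \<and> smooth_on I b \<and>
     (\<forall>u\<in>I. a u > 0) \<and>
     (\<forall>u\<in>I. norm (vector_derivative (profile_curve a b) (at u within I)) = 1)"

definition rev_param_v :: "(real \<Rightarrow> real) \<Rightarrow> (real \<Rightarrow> real) \<Rightarrow> real \<Rightarrow> real \<Rightarrow> real ^ 3" where
  "rev_param_v a b u v = vector_derivative (\<lambda>w. rev_param a b u w) (at v)"

definition meridian :: "real set \<Rightarrow> (real \<Rightarrow> real) \<Rightarrow> (real \<Rightarrow> real) \<Rightarrow> real \<Rightarrow> (real ^ 3) set" where
  "meridian I a b v\<^sub>0 = (\<lambda>u. rev_param a b u v\<^sub>0) ` I"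

definition catenary_energy ::
  "real \<Rightarrow> (real \<Rightarrow> real) \<Rightarrow> real \<Rightarrow> real \<Rightarrow> (real \<Rightarrow> real) \<Rightarrow> (real \<Rightarrow> real) \<Rightarrow> real" where
  "catenary_energy \<alpha> a t\<^sub>0 t\<^sub>1 u v =
     integral {t\<^sub>0..t\<^sub>1} (\<lambda>t. u t powr \<alpha> *
       sqrt ((vector_derivative u (at t within {t\<^sub>0..t\<^sub>1}))\<^sup>2 +
             (a (u t))\<^sup>2 * (vector_derivative v (at t within {t\<^sub>0..t\<^sub>1}))\<^sup>2))"

definition proper_variation ::
  "real set \<Rightarrow> real \<Rightarrow> real \<Rightarrow> (real \<Rightarrow> real) \<Rightarrow> (real \<Rightarrow> real) \<Rightarrow>
   real \<Rightarrow> (real \<Rightarrow> real \<Rightarrow> real) \<Rightarrow> (real \<Rightarrow> real \<Rightarrow> real) \<Rightarrow> bool" where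
  "proper_variation I t\<^sub>0 t\<^sub>1 u v \<epsilon> U V \<longleftrightarrow>
     \<epsilon> > 0 \<and>
     smooth_on ({-\<epsilon><..<\<epsilon>} \<times> {t\<^sub>0..t\<^sub>1}) (\<lambda>(s, t). U s t) \<and>
     smooth_on ({-\<epsilon><..<\<epsilon>} \<times> {t\<^sub>0..t\<^sub>1}) (\<lambda>(s, t). V s t) \<and>
     (\<forall>t\<in>{t\<^sub>0..t\<^sub>1}. U 0 t = u t \<and> V 0 t = v t) \<and>
     (\<forall>s\<in>{-\<epsilon><..<\<epsilon>}. U s t\<^sub>0 = u t\<^sub>0 \<and> V s t\<^sub>0 = v t\<^sub>0 \<and> U s t\<^sub>1 = u t\<^sub>1 \<and> V s t\<^sub>1 = v t\<^sub>1) \<and>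
     (\<forall>s\<in>{-\<epsilon><..<\<epsilon>}. \<forall>t\<in>{t\<^sub>0..t\<^sub>1}. U s t \<in> I \<and> U s t > 0)"

definition alpha_catenary ::
  "real \<Rightarrow> real set \<Rightarrow> (real \<Rightarrow> real) \<Rightarrow> real \<Rightarrow> real \<Rightarrow> (real \<Rightarrow> real) \<Rightarrow> (real \<Rightarrow> real) \<Rightarrow> bool" where
  "alpha_catenary \<alpha> I a t\<^sub>0 t\<^sub>1 u v \<longleftrightarrow>
     smooth_on {t\<^sub>0..t\<^sub>1} u \<and> smooth_on {t\<^sub>0..t\<^sub>1} v \<and>
     (\<forall>t\<in>{t\<^sub>0..t\<^sub>1}. u t \<in> I \<and> u t > 0) \<and>
     (\<forall>\<epsilon> U V. proper_variation I t\<^sub>0 t\<^sub>1 u v \<epsilon> U V \<longrightarrow>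
        ((\<lambda>s. catenary_energy \<alpha> a t\<^sub>0 t\<^sub>1 (U s) (V s)) has_real_derivative 0) (at 0))"

end

theory Submission
  imports Defs
begin

text \<open>
  The Lagrangian does not depend on \<open>v\<close>, so the momentum
  \<open>p = u\<^sup>\<alpha> a(u)\<^sup>2 v' / |\<gamma>'| = a(u) u\<^sup>\<alpha> cos \<theta>\<close> conjugate to \<open>v\<close> is conserved (Clairaut).
  Varying only \<open>v\<close>, by \<open>v + s \<eta>\<close> with \<open>\<eta>\<close> vanishing at the endpoints, gives
  \<open>\<integral> p \<eta>' = 0\<close>. Polynomials \<open>\<eta>\<close> suffice: by the Weierstrass approximation theorem
  they force \<open>p\<close> to be equal to its mean value, and no smoothness of \<open>p\<close> is needed.
\<close>

section \<open>Functions of class \<open>C\<^sup>k\<close> on sets with unique derivatives\<close>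

definition axis_perfect :: "'a::euclidean_space set \<Rightarrow> bool" where
  "axis_perfect S \<longleftrightarrow>
     (\<forall>x\<in>S. \<forall>i\<in>Basis. \<forall>e>0. \<exists>d. 0 < \<bar>d\<bar> \<and> \<bar>d\<bar> < e \<and> x + d *\<^sub>R i \<in> S)"

lemma frechet_derivative_within_eq:
  assumes "axis_perfect S" "x \<in> S" "(f has_derivative f') (at x within S)"
  shows "frechet_derivative f (at x within S) = f'"
proof -
  have "(f has_derivative frechet_derivative f (at x within S)) (at x within S)"
    using assms(3) differentiable_def frechet_derivative_works by blast
  then show ?thesis
    using assms unfolding axis_perfect_def by (intro frechet_derivative_unique_within) auto
qed

lemma axis_perfect_atLeastAtMost:
  fixes a b :: real
  assumes "a < b"
  shows "axis_perfect {a..b}"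
  unfolding axis_perfect_def
proof (intro ballI allI impI)
  fix x i e :: real
  assume x: "x \<in> {a..b}" and i: "i \<in> Basis" and e: "0 < e"
  \<comment> \<open>Move to the right, except at the right endpoint, where the only way is to the
    left. The minimum keeps the point in the interval, and \<open>e/2\<close> makes the bound by
    \<open>e\<close> strict.\<close>
  define d where "d = (if x < b then min (e/2) (b - x) else - min (e/2) (b - a))"
  have "0 < \<bar>d\<bar> \<and> \<bar>d\<bar> < e \<and> x + d *\<^sub>R i \<in> {a..b}"
    using x i e assms by (auto simp: d_def min_def)
  then show "\<exists>d. 0 < \<bar>d\<bar> \<and> \<bar>d\<bar> < e \<and> x + d *\<^sub>R i \<in> {a..b}" ..
qed

lemma axis_perfect_open:
  assumes "open S"
  shows "axis_perfect S"
  unfolding axis_perfect_def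
proof (intro ballI allI impI)
  fix x i :: 'a and e :: real
  assume x: "x \<in> S" and i: "i \<in> Basis" and e: "0 < e"
  obtain r where r: "r > 0" "ball x r \<subseteq> S"
    using assms x openE by blast
  have "x + (min e r / 2) *\<^sub>R i \<in> ball x r"
    using i e r by (simp add: dist_norm)
  then show "\<exists>d. 0 < \<bar>d\<bar> \<and> \<bar>d\<bar> < e \<and> x + d *\<^sub>R i \<in> S"
    using e r by (intro exI[of _ "min e r / 2"]) auto
qed

lemma axis_perfect_Times:
  assumes "axis_perfect S" "axis_perfect T"
  shows "axis_perfect (S \<times> T)"
  using assms unfolding axis_perfect_def Basis_prod_def by fastforce

section \<open>Closure properties of \<open>Ck_on\<close>\<close>

lemma Ck_on_cong:
  assumes "\<And>x. x \<in> S \<Longrightarrow> f x = g x"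
  shows "Ck_on k S f \<longleftrightarrow> Ck_on k S g"
  using assms
proof (induction k arbitrary: f g)
  case 0
  then show ?case by (simp cong: continuous_on_cong)
next
  case (Suc k)
  have *: "(f has_derivative D) (at x within S) \<longleftrightarrow> (g has_derivative D) (at x within S)"
    if "x \<in> S" for x D
    using Suc.prems that by (metis has_derivative_transform)
  have "frechet_derivative f (at x within S) = frechet_derivative g (at x within S)"
    if "x \<in> S" for x
    unfolding frechet_derivative_def using *[OF that] by simp
  then have "Ck_on k S (\<lambda>x. frechet_derivative f (at x within S) h) \<longleftrightarrow>
      Ck_on k S (\<lambda>x. frechet_derivative g (at x within S) h)" for h
    by (intro Suc.IH) simp
  then show ?case
    using * by (simp add: differentiable_def)
qed

text \<open>\<open>frechet_derivative\<close> is a choice term. Uniqueness of derivatives within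
  \<open>S\<close> identifies it with any exhibited derivative \<open>f' x\<close>, so inductions on
  the order can work with explicit formulas.\<close>

lemma Ck_on_SucI:
  assumes "axis_perfect S"
    and "\<And>x. x \<in> S \<Longrightarrow> (f has_derivative f' x) (at x within S)"
    and "\<And>h. Ck_on k S (\<lambda>x. f' x h)"
  shows "Ck_on (Suc k) S f"
proof -
  have "Ck_on k S (\<lambda>x. frechet_derivative f (at x within S) h) \<longleftrightarrow> Ck_on k S (\<lambda>x. f' x h)" for h
    by (intro Ck_on_cong) (simp add: frechet_derivative_within_eq[OF assms(1) _ assms(2)])
  then show ?thesis
    using assms by (auto simp: differentiable_def)
qed

lemma Ck_on_has_derivative:
  assumes "Ck_on (Suc k) S f" "x \<in> S"
  shows "(f has_derivative frechet_derivative f (at x within S)) (at x within S)"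
  using assms by (simp flip: frechet_derivative_works)

lemma Ck_on_Suc_imp_Ck_on: "Ck_on (Suc k) S f \<Longrightarrow> Ck_on k S f"
proof (induction k arbitrary: f)
  case 0
  then show ?case
    by (simp add: differentiable_imp_continuous_within continuous_on_eq_continuous_within)
next
  case (Suc k)
  have "Ck_on k S (\<lambda>x. frechet_derivative f (at x within S) h)" for h
    using Suc.prems by (intro Suc.IH) simp
  then show ?case
    using Suc.prems by simp
qed

lemma Ck_on_const:
  assumes "axis_perfect S"
  shows "Ck_on k S (\<lambda>x. c)"
  using assms
proof (induction k arbitrary: c)
  case (Suc k)
  then show ?case
    by (intro Ck_on_SucI[where f' = "\<lambda>x h. 0"]) auto
qed simp

lemma Ck_on_bounded_linear:
  assumes "axis_perfect S" "bounded_linear f"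
  shows "Ck_on k S f"
proof (cases k)
  case 0
  then show ?thesis
    using assms by (simp add: linear_continuous_on)
next
  case (Suc n)
  then show ?thesis
    using assms Ck_on_SucI[where f' = "\<lambda>x. f"] bounded_linear_imp_has_derivative Ck_on_const
    by metis
qed

lemma Ck_on_add:
  assumes "axis_perfect S" "Ck_on k S f" "Ck_on k S g"
  shows "Ck_on k S (\<lambda>x. f x + g x)"
  using assms
proof (induction k arbitrary: f g)
  case 0
  then show ?case by (simp add: continuous_on_add)
next
  case (Suc k)
  show ?case
  proof (rule Ck_on_SucI[OF Suc.prems(1)])
    show "((\<lambda>x. f x + g x) has_derivative (\<lambda>h. frechet_derivative f (at x within S) h +
        frechet_derivative g (at x within S) h)) (at x within S)" if "x \<in> S" for x
      using Suc.prems that by (intro has_derivative_add Ck_on_has_derivative)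
    show "Ck_on k S (\<lambda>x. frechet_derivative f (at x within S) h +
        frechet_derivative g (at x within S) h)" for h
      using Suc by simp
  qed
qed

lemma Ck_on_mult:
  fixes f g :: "'a::euclidean_space \<Rightarrow> real"
  assumes "axis_perfect S" "Ck_on k S f" "Ck_on k S g"
  shows "Ck_on k S (\<lambda>x. f x * g x)"
  using assms
proof (induction k arbitrary: f g)
  case 0
  then show ?case by (simp add: continuous_on_mult)
next
  case (Suc k)
  show ?case
  proof (rule Ck_on_SucI[OF Suc.prems(1)])
    show "((\<lambda>x. f x * g x) has_derivative (\<lambda>h. f x * frechet_derivative g (at x within S) h +
        frechet_derivative f (at x within S) h * g x)) (at x within S)" if "x \<in> S" for x
      using Suc.prems that by (intro has_derivative_mult Ck_on_has_derivative)
    show "Ck_on k S (\<lambda>x. f x * frechet_derivative g (at x within S) h +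
        frechet_derivative f (at x within S) h * g x)" for h
      \<comment> \<open>The product rule keeps the undifferentiated factors \<open>f\<close> and
        \<open>g\<close>, which must first be lowered from order \<open>Suc k\<close> to order
        \<open>k\<close>.\<close>
      using Suc.prems Ck_on_Suc_imp_Ck_on[OF Suc.prems(2)] Ck_on_Suc_imp_Ck_on[OF Suc.prems(3)]
      by (intro Ck_on_add Suc.IH) simp_all
  qed
qed

text \<open>The inner map is linear, so for a fixed direction \<open>h\<close> the derivative is
  again a function of \<open>snd x\<close> alone, namely the derivative of \<open>f\<close> in the
  fixed direction \<open>snd h\<close>. The induction therefore closes without a general chain rule
  of order \<open>k\<close>. It lifts functions of \<open>t\<close> to functions of
  \<open>(s, t)\<close>.\<close>

lemma Ck_on_compose_snd:
  fixes S :: "'a::euclidean_space set" and T :: "'b::euclidean_space set"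
  assumes "axis_perfect (S \<times> T)" "Ck_on k T f"
  shows "Ck_on k (S \<times> T) (\<lambda>x. f (snd x))"
  using assms
proof (induction k arbitrary: f)
  case 0
  then show ?case
    by (auto intro!: continuous_intros continuous_on_compose2[of T f])
next
  case (Suc k)
  show ?case
  proof (rule Ck_on_SucI[OF Suc.prems(1)])
    fix x assume x: "x \<in> S \<times> T"
    have "(f has_derivative frechet_derivative f (at (snd x) within T)) (at (snd x) within T)"
      using Suc.prems x by (intro Ck_on_has_derivative) auto
    moreover have "snd ` (S \<times> T) \<subseteq> T"
      by auto
    ultimately have "(f has_derivative frechet_derivative f (at (snd x) within T))
        (at (snd x) within snd ` (S \<times> T))"
      by (rule has_derivative_subset)
    with bounded_linear_imp_has_derivative[OF bounded_linear_snd]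
    show "((\<lambda>x. f (snd x)) has_derivative
        (\<lambda>h. frechet_derivative f (at (snd x) within T) (snd h))) (at x within S \<times> T)"
      by (rule has_derivative_in_compose)
  next
    fix h
    show "Ck_on k (S \<times> T) (\<lambda>x. frechet_derivative f (at (snd x) within T) (snd h))"
      using Suc.prems by (intro Suc.IH) auto
  qed
qed

lemma Ck_on_real_polynomial_function:
  fixes p :: "'a::euclidean_space \<Rightarrow> real"
  assumes "axis_perfect S" "real_polynomial_function p"
  shows "Ck_on k S p"
  using assms(2)
  by (induction rule: real_polynomial_function.induct)
     (auto intro: assms(1) Ck_on_bounded_linear Ck_on_const Ck_on_add Ck_on_mult)

section \<open>Derivatives of functions of one real variable\<close>

lemma at_within_Icc_neq_bot:
  fixes a b :: real
  assumes "a < b" "t \<in> {a..b}"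
  shows "at t within {a..b} \<noteq> bot"
  using assms by (simp add: trivial_limit_within)

lemma Ck_on_has_vector_derivative:
  fixes f :: "real \<Rightarrow> 'b::real_normed_vector"
  assumes "Ck_on (Suc k) S f" "x \<in> S"
  shows "(f has_vector_derivative vector_derivative f (at x within S)) (at x within S)"
  using assms by (simp flip: vector_derivative_works)

lemma continuous_on_vector_derivative_Ck_on:
  fixes f :: "real \<Rightarrow> 'b::real_normed_vector"
  assumes "axis_perfect S" "Ck_on (Suc 0) S f"
  shows "continuous_on S (\<lambda>x. vector_derivative f (at x within S))"
proof -
  have "vector_derivative f (at x within S) = frechet_derivative f (at x within S) 1"
    if "x \<in> S" for x
    using Ck_on_has_vector_derivative[OF assms(2) that]
    by (simp add: has_vector_derivative_def frechet_derivative_within_eq[OF assms(1) that])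
  then show ?thesis
    using assms(2) by (simp cong: continuous_on_cong)
qed

section \<open>The lemma of du Bois-Reymond\<close>

text \<open>Integrate term by term. The primitive turns an arbitrary test polynomial into the
  derivative of a polynomial variation.\<close>

lemma real_polynomial_function_primitive:
  fixes q :: "real \<Rightarrow> real"
  assumes "real_polynomial_function q"
  obtains Q where "real_polynomial_function Q"
    "\<And>x. (Q has_real_derivative q x) (at x)"
proof -
  obtain a n where q: "q = (\<lambda>x. \<Sum>i\<le>n. a i * x ^ i)"
    using assms real_polynomial_function_iff_sum by auto
  define Q where "Q = (\<lambda>x::real. \<Sum>i\<le>n. a i / real (Suc i) * x ^ Suc i)"
  have "real_polynomial_function Q"
    unfolding Q_def
    by (intro real_polynomial_function_sum real_polynomial_function_power
        real_polynomial_function.intros) auto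
  moreover have "(Q has_real_derivative q x) (at x)" for x
    unfolding Q_def q
    by (rule derivative_eq_intros refl | simp add: mult.commute)+
  ultimately show ?thesis
    using that by blast
qed

lemma du_Bois_Reymond:
  fixes p :: "real \<Rightarrow> real"
  assumes "a < b" and cont: "continuous_on {a..b} p"
    and crit: "\<And>\<eta> \<eta>'. real_polynomial_function \<eta> \<Longrightarrow> continuous_on UNIV \<eta>' \<Longrightarrow>
      (\<And>t. (\<eta> has_real_derivative \<eta>' t) (at t)) \<Longrightarrow>
      \<eta> a = 0 \<Longrightarrow> \<eta> b = 0 \<Longrightarrow> integral {a..b} (\<lambda>t. p t * \<eta>' t) = 0"
  shows "\<exists>c. \<forall>t\<in>{a..b}. p t = c"
proof -
  define c where "c = integral {a..b} p / (b - a)"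
  define r where "r = (\<lambda>t. p t - c)"
  have cont_r: "continuous_on {a..b} r"
    unfolding r_def by (intro continuous_intros cont)
  have orth: "integral {a..b} (\<lambda>t. r t * q t) = 0" if q: "real_polynomial_function q" for q
  proof -
    have cont_q: "continuous_on X q" for X
      using q continuous_on_polymonial_function real_polynomial_function_eq by blast
    obtain Q where Q: "real_polynomial_function Q" "\<And>x. (Q has_real_derivative q x) (at x)"
      using real_polynomial_function_primitive q by blast
    \<comment> \<open>\<open>m\<close> is the slope of the chord of \<open>Q\<close> over
      \<open>{a..b}\<close>, which is the mean value of \<open>q\<close>.\<close>
    define m where "m = (Q b - Q a) / (b - a)"
    have "(q has_integral (Q b - Q a)) {a..b}"
      using \<open>a < b\<close> Q(2)
      by (intro fundamental_theorem_of_calculus)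
         (auto simp flip: has_real_derivative_iff_has_vector_derivative
               intro: has_field_derivative_at_within)
    then have int_q: "integral {a..b} q = m * (b - a)"
      using \<open>a < b\<close> by (simp add: m_def integral_unique)
    have int_p: "integral {a..b} p = c * (b - a)"
      using \<open>a < b\<close> by (simp add: c_def)
    have "integral {a..b} (\<lambda>t. p t * (q t - m)) = 0"
    \<comment> \<open>Subtracting its chord from \<open>Q\<close> gives a polynomial that vanishes
      at both endpoints and has derivative \<open>q - m\<close>.\<close>
    proof (rule crit[where \<eta> = "\<lambda>t. Q t - Q a - m * (t - a)"])
      show "real_polynomial_function (\<lambda>t. Q t - Q a - m * (t - a))"
        by (intro real_polynomial_function_diff Q real_polynomial_function.intros) auto
      show "((\<lambda>t. Q t - Q a - m * (t - a)) has_real_derivative q t - m) (at t)" for t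
        by (rule derivative_eq_intros Q refl | simp)+
      show "continuous_on UNIV (\<lambda>t. q t - m)"
        by (intro continuous_intros cont_q)
    qed (use \<open>a < b\<close> in \<open>auto simp: m_def\<close>)
    moreover have "integral {a..b} (\<lambda>t. p t * (q t - m)) =
        integral {a..b} (\<lambda>t. p t * q t) - m * integral {a..b} p"
      using cont cont_q
      by (simp add: right_diff_distrib mult.commute[of _ m] integral_diff
          integrable_continuous_real continuous_on_mult)
    moreover have "integral {a..b} (\<lambda>t. r t * q t) =
        integral {a..b} (\<lambda>t. p t * q t) - c * integral {a..b} q"
      unfolding r_def using cont cont_q
      by (simp add: left_diff_distrib integral_diff
          integrable_continuous_real continuous_on_mult)
    \<comment> \<open>The integral of \<open>p * q\<close> equals \<open>m\<close> times that of
      \<open>p\<close>, that is \<open>m * c * (b - a)\<close>, which is also \<open>c\<close> times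
      the integral of \<open>q\<close>.\<close>
    ultimately show ?thesis
      by (simp add: int_p int_q)
  qed
  have "compact (r ` {a..b})"
    using cont_r by (intro compact_continuous_image) auto
  then obtain M where M: "\<And>t. t \<in> {a..b} \<Longrightarrow> \<bar>r t\<bar> \<le> M"
    using compact_imp_bounded bounded_iff by (metis imageI real_norm_def)
  have "M \<ge> 0"
    using M[of a] \<open>a < b\<close> by auto
  \<comment> \<open>Since \<open>r\<close> is orthogonal to every polynomial, one factor of its
    square may be replaced by \<open>r - q\<close>, with \<open>q\<close> uniformly
    \<open>e\<close>-close to \<open>r\<close>.\<close>
  have bound: "integral {a..b} (\<lambda>t. (r t)\<^sup>2) \<le> M * (b - a) * e" if "e > 0" for e
  proof -
    obtain q where q: "real_polynomial_function q" "\<And>t. t \<in> {a..b} \<Longrightarrow> \<bar>r t - q t\<bar> < e"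
      using Stone_Weierstrass_real_polynomial_function[OF compact_Icc cont_r \<open>e > 0\<close>] by blast
    have cont_q: "continuous_on X q" for X
      using q continuous_on_polymonial_function real_polynomial_function_eq by blast
    have "integral {a..b} (\<lambda>t. (r t)\<^sup>2) =
        integral {a..b} (\<lambda>t. (r t)\<^sup>2) - integral {a..b} (\<lambda>t. r t * q t)"
      using orth q by simp
    also have "\<dots> = integral {a..b} (\<lambda>t. (r t)\<^sup>2 - r t * q t)"
      using cont_r cont_q
      by (intro integral_diff[symmetric] integrable_continuous_real continuous_intros)
    also have "\<dots> = integral {a..b} (\<lambda>t. r t * (r t - q t))"
      by (simp add: power2_eq_square right_diff_distrib)
    also have "\<dots> \<le> norm (integral {a..b} (\<lambda>t. r t * (r t - q t)))"
      by simp
    also have "\<dots> \<le> M * e * (b - a)"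
    proof (rule integral_bound)
      show "norm (r t * (r t - q t)) \<le> M * e" if "t \<in> {a..b}" for t
        using M[OF that] q(2)[OF that] \<open>M \<ge> 0\<close>
        by (simp add: abs_mult mult_mono)
    qed (use \<open>a < b\<close> cont_r cont_q in \<open>auto intro!: continuous_intros\<close>)
    finally show ?thesis
      by (simp add: algebra_simps)
  qed
  have "integral {a..b} (\<lambda>t. (r t)\<^sup>2) \<le> 0"
  proof (rule field_le_epsilon)
    fix e :: real assume "e > 0"
    have K: "M * (b - a) \<ge> 0"
      using \<open>M \<ge> 0\<close> \<open>a < b\<close> by simp
    \<comment> \<open>The summand 1 keeps the denominator positive even if
      \<open>M = 0\<close>.\<close>
    have "integral {a..b} (\<lambda>t. (r t)\<^sup>2) \<le> M * (b - a) * (e / (M * (b - a) + 1))"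
      using K \<open>e > 0\<close> by (intro bound) simp
    also have "\<dots> \<le> e"
      using K \<open>e > 0\<close> by (simp add: field_simps)
    finally show "integral {a..b} (\<lambda>t. (r t)\<^sup>2) \<le> 0 + e"
      by simp
  qed
  moreover have "integral {a..b} (\<lambda>t. (r t)\<^sup>2) \<ge> 0"
    using cont_r by (intro integral_nonneg integrable_continuous_real continuous_intros) auto
  ultimately have "\<forall>t\<in>{a..b}. (r t)\<^sup>2 = 0"
    using cont_r \<open>a < b\<close>
    by (intro integral_eq_0_iff[THEN iffD1] continuous_intros) auto
  then show ?thesis
    by (auto simp: r_def)
qed

section \<open>First variation in the direction of the parallels\<close>

text \<open>Differentiation under the integral sign. In the application \<open>w\<close> is
  \<open>u powr \<alpha>\<close>, \<open>f\<close> and \<open>g\<close> are the derivatives of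
  \<open>u\<close> and \<open>v\<close>, \<open>A\<close> is \<open>a\<close> along the curve, and
  \<open>h\<close> is the derivative of the variation. The square root is differentiable only where
  its radicand is positive, so \<open>s\<close> must first be confined to an interval on which
  positivity persists for all \<open>t\<close> at once.\<close>

lemma weighted_length_variation:
  fixes w f g h A :: "real \<Rightarrow> real"
  assumes "t\<^sub>0 < t\<^sub>1"
    and cont: "continuous_on {t\<^sub>0..t\<^sub>1} w" "continuous_on {t\<^sub>0..t\<^sub>1} f"
      "continuous_on {t\<^sub>0..t\<^sub>1} A" "continuous_on {t\<^sub>0..t\<^sub>1} g" "continuous_on {t\<^sub>0..t\<^sub>1} h"
    and pos: "\<And>t. t \<in> {t\<^sub>0..t\<^sub>1} \<Longrightarrow> (f t)\<^sup>2 + (A t)\<^sup>2 * (g t)\<^sup>2 > 0"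
  shows "((\<lambda>s. integral {t\<^sub>0..t\<^sub>1} (\<lambda>t. w t * sqrt ((f t)\<^sup>2 + (A t)\<^sup>2 * (g t + s * h t)\<^sup>2)))
    has_real_derivative
    integral {t\<^sub>0..t\<^sub>1} (\<lambda>t. w t * (A t)\<^sup>2 * g t / sqrt ((f t)\<^sup>2 + (A t)\<^sup>2 * (g t)\<^sup>2) * h t)) (at 0)"
proof -
  let ?R = "\<lambda>s t. (f t)\<^sup>2 + (A t)\<^sup>2 * (g t + s * h t)\<^sup>2"
  let ?D = "\<lambda>s t. w t * (A t)\<^sup>2 * (g t + s * h t) / sqrt (?R s t) * h t"
  have "\<exists>\<tau>\<in>{t\<^sub>0..t\<^sub>1}. \<forall>t\<in>{t\<^sub>0..t\<^sub>1}.
      (f \<tau>)\<^sup>2 + (A \<tau>)\<^sup>2 * (g \<tau>)\<^sup>2 \<le> (f t)\<^sup>2 + (A t)\<^sup>2 * (g t)\<^sup>2"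
    using \<open>t\<^sub>0 < t\<^sub>1\<close>
    by (intro continuous_attains_inf compact_Icc continuous_intros cont) simp
  then obtain \<tau> where \<tau>: "\<tau> \<in> {t\<^sub>0..t\<^sub>1}"
    "\<And>t. t \<in> {t\<^sub>0..t\<^sub>1} \<Longrightarrow> (f \<tau>)\<^sup>2 + (A \<tau>)\<^sup>2 * (g \<tau>)\<^sup>2 \<le> (f t)\<^sup>2 + (A t)\<^sup>2 * (g t)\<^sup>2"
    by blast
  define m where "m = (f \<tau>)\<^sup>2 + (A \<tau>)\<^sup>2 * (g \<tau>)\<^sup>2"
  have m: "m > 0" "\<And>t. t \<in> {t\<^sub>0..t\<^sub>1} \<Longrightarrow> m \<le> (f t)\<^sup>2 + (A t)\<^sup>2 * (g t)\<^sup>2"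
    using pos \<tau> by (auto simp: m_def)
  have "compact ((\<lambda>t. 2 * ((A t)\<^sup>2 * g t * h t)) ` {t\<^sub>0..t\<^sub>1})"
    by (intro compact_continuous_image continuous_intros cont compact_Icc)
  then have "bounded ((\<lambda>t. 2 * ((A t)\<^sup>2 * g t * h t)) ` {t\<^sub>0..t\<^sub>1})"
    by (rule compact_imp_bounded)
  then obtain B where B: "B > 0"
    "\<And>t. t \<in> {t\<^sub>0..t\<^sub>1} \<Longrightarrow> \<bar>2 * ((A t)\<^sup>2 * g t * h t)\<bar> \<le> B"
    by (auto simp only: bounded_pos ball_simps real_norm_def)
  \<comment> \<open>Expanding the radicand in \<open>s\<close>, only the linear term can be
    negative, and for \<bar>s\<bar> < \<delta> it is at most \<delta> * B = m/2 in absolute value,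
    which is less than the minimum \<open>m\<close> of the radicand at \<open>s = 0\<close>.\<close>
  define \<delta> where "\<delta> = m / (2 * B)"
  have \<delta>: "\<delta> > 0"
    using m B by (simp add: \<delta>_def)
  have R_pos: "?R s t > 0" if "s \<in> {-\<delta><..<\<delta>}" "t \<in> {t\<^sub>0..t\<^sub>1}" for s t
  proof -
    have "\<bar>s * (2 * ((A t)\<^sup>2 * g t * h t))\<bar> \<le> \<delta> * B"
      unfolding abs_mult[of s] using that B(2)[of t] by (intro mult_mono) auto
    also have "\<dots> < m"
      using m B by (simp add: \<delta>_def)
    finally have "- m < s * (2 * ((A t)\<^sup>2 * g t * h t))"
      by linarith
    moreover have "?R s t = (f t)\<^sup>2 + (A t)\<^sup>2 * (g t)\<^sup>2 + s * (2 * ((A t)\<^sup>2 * g t * h t))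
        + (A t * (s * h t))\<^sup>2"
      by (simp add: power2_eq_square algebra_simps)
    ultimately show ?thesis
      using m(2)[OF that(2)] zero_le_power2[of "A t * (s * h t)"] by linarith
  qed
  have "((\<lambda>s. integral (cbox t\<^sub>0 t\<^sub>1) (\<lambda>t. w t * sqrt (?R s t))) has_field_derivative
      integral (cbox t\<^sub>0 t\<^sub>1) (?D 0)) (at 0 within {-\<delta><..<\<delta>})"
  proof (rule leibniz_rule_field_derivative)
    fix s t assume st: "s \<in> {-\<delta><..<\<delta>}" "t \<in> cbox t\<^sub>0 t\<^sub>1"
    have "((\<lambda>s. w t * sqrt (?R s t)) has_real_derivative ?D s t) (at s)"
      using R_pos[of s t] st
      by (auto intro!: derivative_eq_intros simp: field_simps)
    then show "((\<lambda>s. w t * sqrt (?R s t)) has_real_derivative ?D s t) (at s within {-\<delta><..<\<delta>})"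
      by (rule has_field_derivative_at_within)
  next
    fix s show "(\<lambda>t. w t * sqrt (?R s t)) integrable_on cbox t\<^sub>0 t\<^sub>1"
      using cont by (auto intro!: integrable_continuous_real continuous_intros)
  next
    \<comment> \<open>The coefficients depend on \<open>t\<close> only; composing with
      \<open>snd\<close> makes them continuous in \<open>(s, t)\<close>.\<close>
    note [continuous_intros] = cont[THEN continuous_on_compose2, OF continuous_on_snd]
    show "continuous_on ({-\<delta><..<\<delta>} \<times> cbox t\<^sub>0 t\<^sub>1) (\<lambda>(s, t). ?D s t)"
      unfolding case_prod_beta using R_pos
      by (intro continuous_intros) (auto simp: less_imp_neq[symmetric])
  qed (use \<delta> in auto)
  then show ?thesis
    using \<delta> at_within_open[of 0 "{-\<delta><..<\<delta>}"] by simp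
qed

section \<open>Curves on surfaces of revolution\<close>

lemma vector_3_eq_sum_axis:
  "(vector [x, y, z] :: real ^ 3) = x *\<^sub>R axis 1 1 + y *\<^sub>R axis 2 1 + z *\<^sub>R axis 3 1"
  by (simp add: vec_eq_iff forall_3 axis_def)

lemma has_vector_derivative_vector_3:
  assumes "(f has_real_derivative f') F" "(g has_real_derivative g') F" "(h has_real_derivative h') F"
  shows "((\<lambda>t. vector [f t, g t, h t] :: real ^ 3) has_vector_derivative vector [f', g', h']) F"
  unfolding vector_3_eq_sum_axis
  using assms[unfolded has_real_derivative_iff_has_vector_derivative]
  by (intro has_vector_derivative_add
      bounded_linear.has_vector_derivative[OF bounded_linear_scaleR_left])

lemma norm_vector_3: "norm (vector [x, y, z] :: real ^ 3) = sqrt (x\<^sup>2 + y\<^sup>2 + z\<^sup>2)"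
  by (simp add: norm_vec_def L2_set_def sum_3)

lemma inner_vector_3:
  "(vector [x, y, z] :: real ^ 3) \<bullet> vector [x', y', z'] = x * x' + y * y' + z * z'"
  by (simp add: inner_vec_def sum_3)

lemma rev_param_v_eq: "rev_param_v a b u v = vector [- (a u * sin v), a u * cos v, 0]"
  unfolding rev_param_v_def rev_param_def
  by (intro vector_derivative_at has_vector_derivative_vector_3)
     (auto intro!: derivative_eq_intros)

lemma profile_unit_speed:
  assumes "surface_of_revolution I a b" "u \<in> I" "u > 0"
  obtains a' b' where "(a has_real_derivative a') (at u within I)"
    "(b has_real_derivative b') (at u within I)" "a'\<^sup>2 + b'\<^sup>2 = 1"
proof -
  \<comment> \<open>\<open>I\<close> contains both 0 and the positive number \<open>u\<close>, so it
    is not a single point. Being connected, it has no isolated points, and the vector derivative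
    within \<open>I\<close> is determined.\<close>
  have "I \<noteq> {x}" for x
    using assms by (auto simp: surface_of_revolution_def)
  moreover have "connected I"
    using assms by (simp add: surface_of_revolution_def is_interval_connected)
  ultimately have nb: "at u within I \<noteq> bot"
    using connected_imp_perfect[of I u] assms(2) by (simp add: trivial_limit_within)
  have "Ck_on (Suc 0) I a" "Ck_on (Suc 0) I b"
    using assms by (simp_all only: surface_of_revolution_def smooth_on_def)
  then obtain a' b' where ab: "(a has_real_derivative a') (at u within I)"
    "(b has_real_derivative b') (at u within I)"
    using assms(2) by (meson Ck_on.simps(2) real_differentiable_def)
  have "(profile_curve a b has_vector_derivative vector [a', 0, b']) (at u within I)"
    unfolding profile_curve_def using ab
    by (intro has_vector_derivative_vector_3) auto
  then have "vector_derivative (profile_curve a b) (at u within I) = vector [a', 0, b']"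
    using nb vector_derivative_within by blast
  moreover have "norm (vector_derivative (profile_curve a b) (at u within I)) = 1"
    using assms by (simp add: surface_of_revolution_def)
  ultimately have "a'\<^sup>2 + b'\<^sup>2 = 1"
    by (simp add: norm_vector_3)
  with ab show ?thesis
    using that by blast
qed

text \<open>This is the induced metric. The meridian part of the velocity has squared length
  \<open>u'\<^sup>2 * (a'\<^sup>2 + b'\<^sup>2) = u'\<^sup>2\<close> by unit speed, the part along
  the parallel has length \<bar>a v'\<bar>, and the two are orthogonal.\<close>

lemma rev_param_curve_velocity:
  assumes "surface_of_revolution I a b" "at t within S \<noteq> bot" "t \<in> S"
    and u: "(u has_real_derivative u') (at t within S)" "u ` S \<subseteq> I" "u t > 0"
    and v: "(v has_real_derivative v') (at t within S)"
  defines "\<gamma>' \<equiv> vector_derivative (\<lambda>t. rev_param a b (u t) (v t)) (at t within S)"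
  shows "norm \<gamma>' = sqrt (u'\<^sup>2 + (a (u t))\<^sup>2 * v'\<^sup>2)"
    and "rev_param_v a b (u t) (v t) \<bullet> \<gamma>' = (a (u t))\<^sup>2 * v'"
proof -
  obtain a' b' where a': "(a has_real_derivative a') (at (u t) within I)"
    and b': "(b has_real_derivative b') (at (u t) within I)" and unit: "a'\<^sup>2 + b'\<^sup>2 = 1"
    using profile_unit_speed assms(1) u \<open>t \<in> S\<close> by (metis image_subset_iff)
  \<comment> \<open>\<open>a\<close> is differentiable only within \<open>I\<close>, so the chain
    rule uses that \<open>u\<close> maps \<open>S\<close> into \<open>I\<close>.\<close>
  have au: "((\<lambda>t. a (u t)) has_real_derivative a' * u') (at t within S)"
    using DERIV_image_chain[OF DERIV_subset[OF a' u(2)] u(1)] by (simp add: o_def)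
  have bu: "((\<lambda>t. b (u t)) has_real_derivative b' * u') (at t within S)"
    using DERIV_image_chain[OF DERIV_subset[OF b' u(2)] u(1)] by (simp add: o_def)
  have "((\<lambda>t. rev_param a b (u t) (v t)) has_vector_derivative
      vector [a' * u' * cos (v t) - a (u t) * v' * sin (v t),
              a' * u' * sin (v t) + a (u t) * v' * cos (v t), b' * u']) (at t within S)"
    unfolding rev_param_def using au bu v
    by (intro has_vector_derivative_vector_3)
       (auto intro!: derivative_eq_intros simp: algebra_simps)
  then have \<gamma>': "\<gamma>' = vector [a' * u' * cos (v t) - a (u t) * v' * sin (v t),
              a' * u' * sin (v t) + a (u t) * v' * cos (v t), b' * u']"
    unfolding \<gamma>'_def using assms(2) vector_derivative_within by blast
  have sc: "(sin (v t))\<^sup>2 + (cos (v t))\<^sup>2 = 1"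
    by simp
  have "(a' * u' * cos (v t) - a (u t) * v' * sin (v t))\<^sup>2 +
      (a' * u' * sin (v t) + a (u t) * v' * cos (v t))\<^sup>2 + (b' * u')\<^sup>2
      = u'\<^sup>2 + (a (u t))\<^sup>2 * v'\<^sup>2"
    using unit sc by algebra
  then show "norm \<gamma>' = sqrt (u'\<^sup>2 + (a (u t))\<^sup>2 * v'\<^sup>2)"
    by (simp add: \<gamma>' norm_vector_3)
  have "- (a (u t) * sin (v t)) * (a' * u' * cos (v t) - a (u t) * v' * sin (v t)) +
      a (u t) * cos (v t) * (a' * u' * sin (v t) + a (u t) * v' * cos (v t)) + 0 * (b' * u')
      = (a (u t))\<^sup>2 * v'"
    using sc by algebra
  then show "rev_param_v a b (u t) (v t) \<bullet> \<gamma>' = (a (u t))\<^sup>2 * v'"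
    by (simp only: \<gamma>' rev_param_v_eq inner_vector_3)
qed

lemma norm_rev_param_v: "norm (rev_param_v a b u v) = \<bar>a u\<bar>"
proof -
  have "(- (a u * sin v))\<^sup>2 + (a u * cos v)\<^sup>2 + 0\<^sup>2 = (a u)\<^sup>2 * ((sin v)\<^sup>2 + (cos v)\<^sup>2)"
    by (simp only: power_mult_distrib distrib_left power2_minus) simp
  then show ?thesis
    by (simp only: rev_param_v_eq norm_vector_3) simp
qed

section \<open>Conservation of the momentum conjugate to \<open>v\<close>\<close>

lemma proper_variation_along_parallels:
  assumes "t\<^sub>0 < t\<^sub>1" "smooth_on {t\<^sub>0..t\<^sub>1} u" "smooth_on {t\<^sub>0..t\<^sub>1} v"
    and "\<And>t. t \<in> {t\<^sub>0..t\<^sub>1} \<Longrightarrow> u t \<in> I \<and> u t > 0"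
    and "real_polynomial_function \<eta>" "\<eta> t\<^sub>0 = 0" "\<eta> t\<^sub>1 = 0"
  shows "proper_variation I t\<^sub>0 t\<^sub>1 u v 1 (\<lambda>s. u) (\<lambda>s t. v t + s * \<eta> t)"
proof -
  let ?S = "{-1<..<1::real}" and ?T = "{t\<^sub>0..t\<^sub>1}"
  have T: "axis_perfect ?T"
    using assms(1) by (rule axis_perfect_atLeastAtMost)
  have ST: "axis_perfect (?S \<times> ?T)"
    by (intro axis_perfect_Times axis_perfect_open T) simp
  have "smooth_on (?S \<times> ?T) (\<lambda>(s, t). u t)"
    unfolding smooth_on_def case_prod_beta
    using assms(2) by (auto intro: Ck_on_compose_snd[OF ST] simp: smooth_on_def)
  moreover have "smooth_on (?S \<times> ?T) (\<lambda>(s, t). v t + s * \<eta> t)"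
    unfolding smooth_on_def case_prod_beta
    using assms(3)
    by (intro allI Ck_on_add[OF ST] Ck_on_mult[OF ST] Ck_on_compose_snd[OF ST]
        Ck_on_bounded_linear[OF ST bounded_linear_fst]
        Ck_on_real_polynomial_function[OF T assms(5)]) (simp add: smooth_on_def)
  \<comment> \<open>The points only slide along their parallels, so \<open>u\<close> stays in
    \<open>I\<close> and positive for every \<open>s\<close>; the variation needs no smallness and
    \<epsilon> = 1 is an arbitrary choice.\<close>
  ultimately show ?thesis
    using assms by (auto simp: proper_variation_def)
qed

lemma alpha_catenary_momentum_constant:
  assumes "t\<^sub>0 < t\<^sub>1" "alpha_catenary \<alpha> I a t\<^sub>0 t\<^sub>1 u v" "continuous_on I a"
  defines "u' \<equiv> \<lambda>t. vector_derivative u (at t within {t\<^sub>0..t\<^sub>1})"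
    and "v' \<equiv> \<lambda>t. vector_derivative v (at t within {t\<^sub>0..t\<^sub>1})"
  assumes regular: "\<And>t. t \<in> {t\<^sub>0..t\<^sub>1} \<Longrightarrow> (u' t)\<^sup>2 + (a (u t))\<^sup>2 * (v' t)\<^sup>2 > 0"
  shows "\<exists>c. \<forall>t\<in>{t\<^sub>0..t\<^sub>1}.
    u t powr \<alpha> * (a (u t))\<^sup>2 * v' t / sqrt ((u' t)\<^sup>2 + (a (u t))\<^sup>2 * (v' t)\<^sup>2) = c"
proof -
  let ?T = "{t\<^sub>0..t\<^sub>1}"
  have smooth: "smooth_on ?T u" "smooth_on ?T v" and u: "\<And>t. t \<in> ?T \<Longrightarrow> u t \<in> I \<and> u t > 0"
    using assms(2) by (auto simp: alpha_catenary_def)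
  have C1: "Ck_on (Suc 0) ?T u" "Ck_on (Suc 0) ?T v"
    using smooth by (simp_all only: smooth_on_def)
  have cont: "continuous_on ?T u" "continuous_on ?T u'" "continuous_on ?T v'"
    using C1 axis_perfect_atLeastAtMost[OF assms(1)]
    \<comment> \<open>Continuity of \<open>u\<close> is folded into \<open>Ck_on 0\<close>, so that
      it follows from class \<open>Ck_on (Suc 0)\<close> by lowering the order.\<close>
    by (auto simp only: u'_def v'_def Ck_on.simps(1)[symmetric]
        intro: Ck_on_Suc_imp_Ck_on)
       (simp_all only: Ck_on.simps(1) continuous_on_vector_derivative_Ck_on)
  have cont_au: "continuous_on ?T (\<lambda>t. a (u t))"
    using assms(3) cont(1) u by (auto intro: continuous_on_compose2)
  have cont_w: "continuous_on ?T (\<lambda>t. u t powr \<alpha>)"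
    using cont(1) u by (intro continuous_intros) force+
  show ?thesis
  proof (rule du_Bois_Reymond[OF assms(1)])
    show "continuous_on ?T (\<lambda>t. u t powr \<alpha> * (a (u t))\<^sup>2 * v' t /
        sqrt ((u' t)\<^sup>2 + (a (u t))\<^sup>2 * (v' t)\<^sup>2))"
      using regular by (intro continuous_intros cont cont_au cont_w) force
  next
    fix \<eta> \<eta>' :: "real \<Rightarrow> real"
    assume \<eta>: "real_polynomial_function \<eta>" "continuous_on UNIV \<eta>'"
      "\<And>t. (\<eta> has_real_derivative \<eta>' t) (at t)" "\<eta> t\<^sub>0 = 0" "\<eta> t\<^sub>1 = 0"
    have "proper_variation I t\<^sub>0 t\<^sub>1 u v 1 (\<lambda>s. u) (\<lambda>s t. v t + s * \<eta> t)"
      by (intro proper_variation_along_parallels assms(1) smooth u \<eta>)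
    then have crit: "((\<lambda>s. catenary_energy \<alpha> a t\<^sub>0 t\<^sub>1 u (\<lambda>t. v t + s * \<eta> t))
        has_real_derivative 0) (at 0)"
      using assms(2) by (auto simp: alpha_catenary_def)
    have "vector_derivative (\<lambda>t. v t + s * \<eta> t) (at t within ?T) = v' t + s * \<eta>' t"
      if "t \<in> ?T" for s t
    proof (rule vector_derivative_within[OF at_within_Icc_neq_bot[OF assms(1) that]])
      have "(v has_real_derivative v' t) (at t within ?T)"
        unfolding v'_def has_real_derivative_iff_has_vector_derivative
        by (rule Ck_on_has_vector_derivative[OF C1(2) that])
      then have "((\<lambda>t. v t + s * \<eta> t) has_real_derivative v' t + s * \<eta>' t) (at t within ?T)"
        using \<eta>(3)[of t, THEN has_field_derivative_at_within]
        by (auto intro!: derivative_eq_intros)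
      then show "((\<lambda>t. v t + s * \<eta> t) has_vector_derivative v' t + s * \<eta>' t) (at t within ?T)"
        by (simp add: has_real_derivative_iff_has_vector_derivative)
    qed
    then have energy: "catenary_energy \<alpha> a t\<^sub>0 t\<^sub>1 u (\<lambda>t. v t + s * \<eta> t) =
        integral ?T (\<lambda>t. u t powr \<alpha> *
          sqrt ((u' t)\<^sup>2 + (a (u t))\<^sup>2 * (v' t + s * \<eta>' t)\<^sup>2))" for s
      unfolding catenary_energy_def u'_def by (intro integral_cong) simp
    show "integral ?T (\<lambda>t. u t powr \<alpha> * (a (u t))\<^sup>2 * v' t /
        sqrt ((u' t)\<^sup>2 + (a (u t))\<^sup>2 * (v' t)\<^sup>2) * \<eta>' t) = 0"
      \<comment> \<open>The energy of the varied curve has derivative 0 at \<open>s = 0\<close> by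
        criticality, and the stated integral by the first variation formula; the two agree.\<close>
      by (intro DERIV_unique[OF _ crit], unfold energy)
         (intro weighted_length_variation assms(1) cont cont_au cont_w regular
           continuous_on_subset[OF \<eta>(2)] subset_UNIV)
  qed
qed

theorem theorem4p1:
  fixes \<alpha> t\<^sub>0 t\<^sub>1 :: real and I :: "real set"
    and a b u v \<theta> :: "real \<Rightarrow> real" and \<gamma> \<gamma>' :: "real \<Rightarrow> real ^ 3"
  assumes "surface_of_revolution I a b"
    and "t\<^sub>0 < t\<^sub>1"
    and "\<And>t. \<gamma> t = rev_param a b (u t) (v t)"
    and "\<And>t. \<gamma>' t = vector_derivative \<gamma> (at t within {t\<^sub>0..t\<^sub>1})"
    and "alpha_catenary \<alpha> I a t\<^sub>0 t\<^sub>1 u v"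
    and "\<And>t. t \<in> {t\<^sub>0..t\<^sub>1} \<Longrightarrow> \<gamma>' t \<noteq> 0"
    and "\<not> (\<exists>v\<^sub>0. \<gamma> ` {t\<^sub>0..t\<^sub>1} \<subseteq> meridian I a b v\<^sub>0)"
    and "\<And>t. t \<in> {t\<^sub>0..t\<^sub>1} \<Longrightarrow>
           cos (\<theta> t) = (rev_param_v a b (u t) (v t) \<bullet> \<gamma>' t) /
                       (norm (rev_param_v a b (u t) (v t)) * norm (\<gamma>' t))"
  shows "\<exists>c::real. \<forall>t\<in>{t\<^sub>0..t\<^sub>1}. a (u t) * u t powr \<alpha> * cos (\<theta> t) = c"
proof -
  let ?T = "{t\<^sub>0..t\<^sub>1}"
  define u' where "u' = (\<lambda>t. vector_derivative u (at t within ?T))"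
  define v' where "v' = (\<lambda>t. vector_derivative v (at t within ?T))"
  have u: "u t \<in> I" "u t > 0" if "t \<in> ?T" for t
    using assms(5) that by (auto simp: alpha_catenary_def)
  have "Ck_on (Suc 0) ?T u" "Ck_on (Suc 0) ?T v"
    using assms(5) by (simp_all only: alpha_catenary_def smooth_on_def)
  then have der: "(u has_real_derivative u' t) (at t within ?T)"
    "(v has_real_derivative v' t) (at t within ?T)" if "t \<in> ?T" for t
    using that Ck_on_has_vector_derivative
    by (auto simp only: u'_def v'_def has_real_derivative_iff_has_vector_derivative)
  have \<gamma>: "\<gamma> = (\<lambda>t. rev_param a b (u t) (v t))"
    using assms(3) by auto
  have velocity: "norm (\<gamma>' t) = sqrt ((u' t)\<^sup>2 + (a (u t))\<^sup>2 * (v' t)\<^sup>2)"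
    "rev_param_v a b (u t) (v t) \<bullet> \<gamma>' t = (a (u t))\<^sup>2 * v' t" if "t \<in> ?T" for t
    unfolding assms(4) \<gamma>
    using rev_param_curve_velocity[OF assms(1) at_within_Icc_neq_bot[OF assms(2) that] that
        der(1)[OF that] _ u(2)[OF that] der(2)[OF that]] u
    by (auto simp: image_subset_iff)
  \<comment> \<open>Regularity of the curve is exactly positivity of the radicand, since its root is
    the speed.\<close>
  have "(u' t)\<^sup>2 + (a (u t))\<^sup>2 * (v' t)\<^sup>2 > 0" if "t \<in> ?T" for t
    using velocity(1)[OF that] assms(6)[OF that] by (metis real_sqrt_gt_0_iff zero_less_norm_iff)
  moreover have "Ck_on 0 I a"
    using assms(1) by (simp only: surface_of_revolution_def smooth_on_def)
  ultimately obtain c where c: "\<forall>t\<in>?T. u t powr \<alpha> * (a (u t))\<^sup>2 * v' t /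
      sqrt ((u' t)\<^sup>2 + (a (u t))\<^sup>2 * (v' t)\<^sup>2) = c"
    using alpha_catenary_momentum_constant[OF assms(2,5)] by (auto simp: u'_def v'_def)
  have "a (u t) * u t powr \<alpha> * cos (\<theta> t) = c" if "t \<in> ?T" for t
  proof -
    \<comment> \<open>As \<open>a > 0\<close>, the vector \<open>rev_param_v\<close> has length
      \<open>a\<close>, and one factor \<open>a\<close> cancels in the quotient for cos \<theta>.
      Multiplying by \<open>a (u t) * u t powr \<alpha>\<close> then yields the conserved
      momentum.\<close>
    have "a (u t) > 0"
      using assms(1) u that by (simp add: surface_of_revolution_def)
    then show ?thesis
      using c that by (simp add: assms(8) velocity norm_rev_param_v power2_eq_square mult_ac)
  qed
  then show ?thesis
    by blast
qed

end
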